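(* Let $L$ be the Leech sequence over $\{A,B,C\}$. There is no substitution instance of $\kappa_1 = abacbcabac$ in $L$; that is, there are no nonempty words $\hat a,\hat b,\hat c\in\{A,B,C\}^+$ such that $\hat a\hat b\hat a\,\hat c\hat b\hat c\,\hat a\hat b\hat a\,\hat c$ occurs as a contiguous subword of $L$. Likewise there is no substitution instance in $L$ of $\kappa_3 = cabacbcaba$ (no word $\hat c\,\hat a\hat b\hat a\,\hat c\hat b\hat c\,\hat a\hat b\hat a$ with $\hat a,\hat b,\hat c\in\{A,B,C\}^+$ occurs as a contiguous subword of $L$), and none of $\kappa_4 = cabacbcabac$ (no word $\hat c\,\hat a\hat b\hat a\,\hat c\hat b\hat c\,\hat a\hat b\hat a\,\hat c$ with $\hat a,\hat b,\hat c\in\{A,B,C\}^+$ occurs as a contiguous subword of $L$).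
   Context: Let $T=\{A,B,C\}$ and let $P:T^+\to T^+$ be the semigroup homomorphism (substitution) determined by $P(A)=ABCBACBCABCBA$, $P(B)=BCACBACABCACB$, $P(C)=CABACBABCABAC$ (each of length 13). Since $P(A)$ begins with $A$, each $P^n(A)$ is a prefix of $P^{n+1}(A)$; the Leech sequence $L$ is the infinite word that is the limit of $A, P(A), P^2(A),\ldots$. *)

theory Defs
  imports Main "HOL-Library.Omega_Words_Fun"
begin

text \<open>
  Finite words are lists, infinite words are functions on the naturals
  (type \<^typ>\<open>'a word\<close> of \<^theory>\<open>HOL-Library.Omega_Words_Fun\<close>); there,
  \<open>w [i \<rightarrow> j]\<close> is the finite factor \<open>w i \<dots> w (j - 1)\<close> of \<open>w\<close>.
\<close>

definition hom_ext :: "('a \<Rightarrow> 'b list) \<Rightarrow> 'a list \<Rightarrow> 'b list" where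
  "hom_ext h u = concat (map h u)"

definition occurs_in :: "'a list \<Rightarrow> 'a word \<Rightarrow> bool" where
  "occurs_in u w \<longleftrightarrow> (\<exists>i j. u = w [i \<rightarrow> j])"

text \<open>Substitutions for pattern variables map every variable to a \<^emph>\<open>nonempty\<close> word.\<close>

definition has_instance :: "'v list \<Rightarrow> 'a word \<Rightarrow> bool" where
  "has_instance p w \<longleftrightarrow> (\<exists>h. (\<forall>v. h v \<noteq> []) \<and> occurs_in (hom_ext h p) w)"


datatype letter = A | B | C

fun leech_block :: "letter \<Rightarrow> letter list" where
  "leech_block A = [A,B,C,B,A,C,B,C,A,B,C,B,A]"
| "leech_block B = [B,C,A,C,B,A,C,A,B,C,A,C,B]"
| "leech_block C = [C,A,B,A,C,B,A,B,C,A,B,A,C]"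

definition leech_subst :: "letter list \<Rightarrow> letter list" where
  "leech_subst = hom_ext leech_block"

definition leech_iter :: "nat \<Rightarrow> letter list" where
  "leech_iter n = (leech_subst ^^ n) [A]"

text \<open>
  The limit of the iterates is the infinite word having all of them as prefixes;
  \<open>leech_ex1\<close> below shows that it exists and is unique.
\<close>

definition leech :: "letter word" where
  "leech = (THE w. \<forall>n. w [0 \<rightarrow> length (leech_iter n)] = leech_iter n)"


datatype var = Va | Vb | Vc

definition kappa1 :: "var list" where
  "kappa1 = [Va,Vb,Va,Vc,Vb,Vc,Va,Vb,Va,Vc]"

definition kappa3 :: "var list" where
  "kappa3 = [Vc,Va,Vb,Va,Vc,Vb,Vc,Va,Vb,Va]"

definition kappa4 :: "var list" where
  "kappa4 = [Vc,Va,Vb,Va,Vc,Vb,Vc,Va,Vb,Va,Vc]"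


lemma hom_ext_Nil [simp]: "hom_ext h [] = []"
  by (simp add: hom_ext_def)

lemma hom_ext_Cons [simp]: "hom_ext h (x # u) = h x @ hom_ext h u"
  by (simp add: hom_ext_def)

lemma hom_ext_append [simp]: "hom_ext h (u @ v) = hom_ext h u @ hom_ext h v"
  by (simp add: hom_ext_def)

lemma leech_iter_0: "leech_iter 0 = [A]"
  by (simp add: leech_iter_def)

lemma leech_iter_Suc: "leech_iter (Suc n) = leech_subst (leech_iter n)"
  by (simp add: leech_iter_def)

lemma length_leech_subst: "length (leech_subst u) = 13 * length u"
proof (induction u)
  case Nil
  then show ?case by (simp add: leech_subst_def)
next
  case (Cons x u)
  then show ?case by (cases x) (simp_all add: leech_subst_def)
qed

lemma length_leech_iter: "length (leech_iter n) = 13 ^ n"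
  by (induction n) (simp_all add: leech_iter_0 leech_iter_Suc length_leech_subst)

lemma leech_iter_extends: "\<exists>v. leech_iter (Suc n) = leech_iter n @ v"
proof (induction n)
  case 0
  then show ?case by (simp add: leech_iter_0 leech_iter_Suc leech_subst_def)
next
  case (Suc n)
  then obtain v where "leech_iter (Suc n) = leech_iter n @ v" by blast
  then have "leech_iter (Suc (Suc n)) = leech_iter (Suc n) @ leech_subst v"
    by (metis leech_iter_Suc leech_subst_def hom_ext_append)
  then show ?case by blast
qed

lemma leech_iter_nth:
  assumes "m \<le> n" and "i < length (leech_iter m)"
  shows "leech_iter n ! i = leech_iter m ! i"
  using assms(1)
proof (induction n rule: dec_induct)
  case base
  then show ?case by simp
next
  case (step n)
  obtain v where "leech_iter (Suc n) = leech_iter n @ v"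
    using leech_iter_extends by blast
  moreover have "(13::nat) ^ m \<le> 13 ^ n"
    using step.hyps(1) by (simp add: power_increasing)
  then have "i < length (leech_iter n)"
    using assms(2) unfolding length_leech_iter by (rule less_le_trans[rotated])
  ultimately show ?case
    using step.IH by (simp add: nth_append)
qed

lemma less_length_leech_iter: "i < length (leech_iter i)"
  unfolding length_leech_iter by (rule less_exp[THEN less_le_trans]) (simp add: power_mono)

lemma leech_ex1: "\<exists>!w. \<forall>n. w [0 \<rightarrow> length (leech_iter n)] = leech_iter n"
proof (rule ex1I)
  show "\<forall>n. (\<lambda>i. leech_iter i ! i) [0 \<rightarrow> length (leech_iter n)] = leech_iter n"
  proof
    fix n
    have "leech_iter i ! i = leech_iter n ! i" if "i < length (leech_iter n)" for i
      using that leech_iter_nth[of i n i] leech_iter_nth[of n i i] less_length_leech_iter[of i]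
      by (cases "i \<le> n") simp_all
    then show "(\<lambda>i. leech_iter i ! i) [0 \<rightarrow> length (leech_iter n)] = leech_iter n"
      by (intro nth_equalityI) (simp_all add: subsequence_def)
  qed
next
  fix w assume w: "\<forall>n. w [0 \<rightarrow> length (leech_iter n)] = leech_iter n"
  show "w = (\<lambda>i. leech_iter i ! i)"
  proof
    fix i
    have "w i = w [0 \<rightarrow> length (leech_iter i)] ! i"
      using less_length_leech_iter[of i] by (simp add: subsequence_def)
    then show "w i = leech_iter i ! i" using w by metis
  qed
qed

lemma leech_prefix: "leech [0 \<rightarrow> length (leech_iter n)] = leech_iter n"
  unfolding leech_def using theI'[OF leech_ex1] by blast

lemma leech_nth: "i < length (leech_iter n) \<Longrightarrow> leech i = leech_iter n ! i"
  using arg_cong[OF leech_prefix[of n], of "\<lambda>u. u ! i"] by (simp add: subsequence_def)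

end

theory Submission
  imports Defs
begin

text \<open>
  Everything reduces to \<^const>\<open>kappa1\<close>. The three blocks of the substitution are palindromes, so
  the iterates are palindromes and the factors of the Leech word are closed under reversal; hence an
  instance of a pattern yields one of the reversed pattern (\<open>has_instance_leech_rev\<close>).
  Now \<^const>\<open>kappa3\<close> is \<^const>\<open>kappa1\<close> reversed, and it is a prefix of \<^const>\<open>kappa4\<close>.

  For \<^const>\<open>kappa1\<close> the argument is an infinite descent. The word is its own image under a
  substitution with blocks of length 13, and every factor of length 8 determines its position
  modulo 13 (\<open>leech_sync\<close>). Hence two equal factors of length at least 8 lie at a distance
  divisible by 13. Let \<open>a\<close>, \<open>b\<close>, \<open>c\<close> be the lengths of the three words of an instance
  \<open>aba cbc aba c\<close>. If \<open>abac\<close>, which occurs twice at distance \<open>2(a + b + c)\<close>, is shorter than 8,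
  the instance fits into the image of three letters and inspection excludes it
  (\<open>no_short_instance\<close>). So 13 divides \<open>a + b + c\<close>, and the two words \<open>ac\<close> and \<open>ca\<close> that separate
  the three occurrences of \<open>b\<close> start at the same residue. Inspection shows that this is impossible
  when \<open>a\<close> and \<open>c\<close> are both below 8 (\<open>no_swapped_gaps\<close>). If one of them is at least 8,
  synchronization gives 13 dividing \<open>a + b\<close> or \<open>b + c\<close>, and then all three lengths turn out to be
  divisible by 13. The last letter of the block of \<open>x\<close> is \<open>x\<close> itself, so reading only the positions
  congruent to 12 modulo 13 turns the instance into one with all lengths divided by 13
  (\<open>coincide_desubst\<close>).

  The exhaustive inspections concern the letters of the images of two or three letter factors, of
  which there are few because adjacent letters of the Leech word are distinct.
\<close>

section \<open>The letters of the Leech word\<close>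

lemma length_leech_block: "length (leech_block x) = 13"
  by (cases x) simp_all

lemma leech_subst_Cons: "leech_subst (x # u) = leech_block x @ leech_subst u"
  by (simp add: leech_subst_def)

lemma leech_subst_nth:
  assumes "q < length u" "r < 13"
  shows "leech_subst u ! (13 * q + r) = leech_block (u ! q) ! r"
  using assms(1)
proof (induction u arbitrary: q)
  case Nil
  then show ?case by simp
next
  case (Cons x u)
  show ?case
  proof (cases q)
    case 0
    then show ?thesis
      using assms(2) by (simp add: leech_subst_Cons nth_append length_leech_block)
  next
    case (Suc q')
    then show ?thesis
      using Cons by (simp add: leech_subst_Cons nth_append length_leech_block)
  qed
qed

lemma leech_fixpoint:
  assumes "r < 13"
  shows "leech (13 * q + r) = leech_block (leech q) ! r"
proof -
  have q: "q < length (leech_iter q)"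
    by (rule less_length_leech_iter)
  then have "13 * q + r < length (leech_iter (Suc q))"
    using assms by (simp add: length_leech_iter)
  then have "leech (13 * q + r) = leech_subst (leech_iter q) ! (13 * q + r)"
    using leech_nth leech_iter_Suc by metis
  also have "\<dots> = leech_block (leech q) ! r"
    using q assms by (simp add: leech_subst_nth leech_nth)
  finally show ?thesis .
qed

lemma leech_first: "leech (13 * q) = leech q"
  using leech_fixpoint[of 0 q] by (cases "leech q") simp_all

lemma leech_last: "leech (13 * q + 12) = leech q"
  using leech_fixpoint[of 12 q] by (cases "leech q") simp_all

text \<open>
  The fixed point equation for factors. It makes every short factor a window in the image of a factor
  of two or three letters, and so accessible to inspection.
\<close>

lemma leech_subst_factor:
  "leech_subst (leech [q \<rightarrow> q + n]) = leech [13 * q \<rightarrow> 13 * q + 13 * n]"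
proof (rule nth_equalityI)
  fix t assume "t < length (leech_subst (leech [q \<rightarrow> q + n]))"
  then have t: "t < 13 * n" by (simp add: length_leech_subst)
  define m r where "m = t div 13" and "r = t mod 13"
  have mr: "t = 13 * m + r" "r < 13" "m < n"
    using t by (auto simp: m_def r_def)
  have "leech (13 * q + t) = leech_block (leech (q + m)) ! r"
    using leech_fixpoint[of r "q + m"] mr by (simp add: algebra_simps)
  with mr t show "leech_subst (leech [q \<rightarrow> q + n]) ! t = leech [13 * q \<rightarrow> 13 * q + 13 * n] ! t"
    by (simp add: leech_subst_nth)
qed (simp add: length_leech_subst)

lemma leech_window:
  assumes "r + k \<le> 13 * n"
  shows "leech [13 * q + r \<rightarrow> 13 * q + r + k] = take k (drop r (leech_subst (leech [q \<rightarrow> q + n])))"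
  unfolding leech_subst_factor using assms
  by (intro nth_equalityI) (simp_all add: add.assoc)

text \<open>
  The first 26 letters from any position on lie within three blocks, as the position is at most 12
  letters into its own block.
\<close>

lemma window_after:
  assumes "s + k \<le> 26"
  shows "leech [i + s \<rightarrow> i + s + k] =
    take k (drop s (drop (i mod 13) (leech_subst (leech [i div 13 \<rightarrow> i div 13 + 3]))))"
proof -
  have "i mod 13 < 13" by simp
  then have "i mod 13 + s + k \<le> 13 * 3" using assms by linarith
  from leech_window[OF this, of "i div 13"]
  have "leech [13 * (i div 13) + (i mod 13 + s) \<rightarrow> 13 * (i div 13) + (i mod 13 + s) + k] =
    take k (drop (i mod 13 + s) (leech_subst (leech [i div 13 \<rightarrow> i div 13 + 3])))" .
  moreover have "13 * (i div 13) + (i mod 13 + s) = i + s" by simp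
  ultimately show ?thesis unfolding drop_drop by (simp only: add.commute[of s])
qed

lemma factor_2: "w [q \<rightarrow> q + 2] = [w q, w (Suc q)]"
  by (simp add: subsequence_def upt_rec)

lemma factor_3: "w [q \<rightarrow> q + 3] = [w q, w (Suc q), w (Suc (Suc q))]"
  by (simp add: subsequence_def upt_rec)


section \<open>Finite inspection of short factors\<close>

definition letter_pairs :: "letter list list" where
  "letter_pairs = [[A,B],[A,C],[B,A],[B,C],[C,A],[C,B]]"

definition letter_triples :: "letter list list" where
  "letter_triples = [[A,B,A],[A,B,C],[A,C,A],[A,C,B],[B,A,B],[B,A,C],
     [B,C,A],[B,C,B],[C,A,B],[C,A,C],[C,B,A],[C,B,C]]"

text \<open>
  Inside a block this is visible. Across a block boundary the two letters are the last and the first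
  letter of consecutive blocks, that is, two adjacent letters further to the left.
\<close>

lemma leech_adjacent: "leech n \<noteq> leech (Suc n)"
proof (induction n rule: less_induct)
  case (less n)
  define q r where "q = n div 13" and "r = n mod 13"
  have n: "n = 13 * q + r" "r < 13" by (auto simp: q_def r_def)
  show ?case
  proof (cases "r = 12")
    case True
    then have "leech q \<noteq> leech (Suc q)" using less n by simp
    moreover have "leech n = leech q" "leech (Suc n) = leech (Suc q)"
      using True n leech_last[of q] leech_first[of "Suc q"] by simp_all
    ultimately show ?thesis by simp
  next
    case False
    have "list_all (\<lambda>x. list_all (\<lambda>r. leech_block x ! r \<noteq> leech_block x ! Suc r) [0..<12]) [A,B,C]"
      by code_simp
    then have "leech_block x ! r \<noteq> leech_block x ! Suc r" if "r < 12" for x r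
      using that by (cases x) (auto simp: list_all_iff)
    then show ?thesis
      using n False leech_fixpoint[of r q] leech_fixpoint[of "Suc r" q] by simp
  qed
qed

lemma leech_pairs: "leech [q \<rightarrow> q + 2] \<in> set letter_pairs"
  using leech_adjacent[of q] unfolding factor_2 letter_pairs_def
  by (cases "leech q"; cases "leech (Suc q)") simp_all

lemma leech_triples: "leech [q \<rightarrow> q + 3] \<in> set letter_triples"
  using leech_adjacent[of q] leech_adjacent[of "Suc q"] unfolding factor_3 letter_triples_def
  by (cases "leech q"; cases "leech (Suc q)"; cases "leech (Suc (Suc q))") simp_all

text \<open>
  The number 8 is the least that works: the factor \<open>ABCACBA\<close> of length 7 occurs at two residues.
  It matters below that 8 does not exceed 13, the length of a block.
\<close>

lemma sync_check:
  "list_all (\<lambda>u. list_all (\<lambda>r. let x = take 8 (drop r (leech_subst u)) in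
     list_all (\<lambda>v. list_all (\<lambda>s. r = s \<or> x \<noteq> take 8 (drop s (leech_subst v))) [0..<13]) letter_pairs)
     [0..<13]) letter_pairs"
  by code_simp

lemma leech_sync:
  assumes "leech [i \<rightarrow> i + 8] = leech [j \<rightarrow> j + 8]"
  shows "i mod 13 = j mod 13"
proof -
  have window: "leech [n \<rightarrow> n + 8] =
      take 8 (drop (n mod 13) (leech_subst (leech [n div 13 \<rightarrow> n div 13 + 2])))" for n
    using leech_window[of "n mod 13" 8 2 "n div 13"] by simp
  have range: "n mod 13 \<in> set [0..<13]" for n :: nat
    by simp
  show ?thesis
    using sync_check leech_pairs[of "i div 13"] leech_pairs[of "j div 13"]
      range[of i] range[of j] assms
    unfolding window list_all_iff Let_def by blast
qed


section \<open>Instances of the first pattern as coinciding factors\<close>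

text \<open>
  The descent manipulates positions and lengths only, so an instance is represented by the position
  where it starts and by the lengths of the three words.
\<close>

definition coincide :: "'a word \<Rightarrow> nat \<Rightarrow> nat \<Rightarrow> nat \<Rightarrow> bool" where
  "coincide w i j n \<longleftrightarrow> w [i \<rightarrow> i + n] = w [j \<rightarrow> j + n]"

lemma coincide_iff: "coincide w i j n \<longleftrightarrow> (\<forall>k<n. w (i + k) = w (j + k))"
  by (auto simp: coincide_def list_eq_iff_nth_eq)

text \<open>
  Occurrences of the same variable carry the same word. In \<open>a b a c b c a b a c\<close> the first
  three equations join the occurrences of \<open>a\<close>, \<open>b\<close>, \<open>c\<close> within the first \<open>a b a c b c\<close>, and the
  last one joins the first \<open>a b a c\<close> to the second.
\<close>

definition kappa1_at :: "'a word \<Rightarrow> nat \<Rightarrow> nat \<Rightarrow> nat \<Rightarrow> nat \<Rightarrow> bool" where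
  "kappa1_at w i a b c \<longleftrightarrow>
     coincide w i (i + a + b) a \<and>
     coincide w (i + a) (i + 2 * a + b + c) b \<and>
     coincide w (i + 2 * a + b) (i + 2 * a + 2 * b + c) c \<and>
     coincide w i (i + 2 * (a + b + c)) (2 * a + b + c)"

lemma factor_middle:
  assumes "w [i \<rightarrow> j] = x @ y @ z"
  shows "y = w [i + length x \<rightarrow> i + length x + length y]"
proof (rule nth_equalityI)
  have len: "j - i = length x + length y + length z"
    using arg_cong[OF assms, of length] by simp
  fix k assume k: "k < length y"
  have "w [i \<rightarrow> j] ! (length x + k) = y ! k"
    unfolding assms using k by (simp add: nth_append)
  then show "y ! k = w [i + length x \<rightarrow> i + length x + length y] ! k"
    using k len by (simp add: add.assoc)
qed simp

lemma coincide_factors: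
  assumes "w [i \<rightarrow> j] = x @ y @ z" "w [i \<rightarrow> j] = x' @ y @ z'"
    and "m = i + length x" "m' = i + length x'" "n = length y"
  shows "coincide w m m' n"
  using factor_middle[OF assms(1)] factor_middle[OF assms(2)] by (simp add: coincide_def assms(3-5))

lemma has_instance_kappa1:
  assumes "has_instance kappa1 w"
  obtains i a b c where "0 < a" "0 < b" "0 < c" "kappa1_at w i a b c"
proof -
  obtain h i j where h: "\<And>v. h v \<noteq> []" and w: "w [i \<rightarrow> j] = hom_ext h kappa1"
    using assms unfolding has_instance_def occurs_in_def by metis
  let ?a = "h Va" and ?b = "h Vb" and ?c = "h Vc"
  have "kappa1_at w i (length ?a) (length ?b) (length ?c)"
    unfolding kappa1_at_def
  proof (intro conjI)
    show "coincide w i (i + length ?a + length ?b) (length ?a)"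
      by (rule coincide_factors[of w i j "[]" ?a "?b @ ?a @ ?c @ ?b @ ?c @ ?a @ ?b @ ?a @ ?c"
          "?a @ ?b" "?c @ ?b @ ?c @ ?a @ ?b @ ?a @ ?c"]) (simp_all add: w kappa1_def)
    show "coincide w (i + length ?a) (i + 2 * length ?a + length ?b + length ?c) (length ?b)"
      by (rule coincide_factors[of w i j ?a ?b "?a @ ?c @ ?b @ ?c @ ?a @ ?b @ ?a @ ?c"
          "?a @ ?b @ ?a @ ?c" "?c @ ?a @ ?b @ ?a @ ?c"]) (simp_all add: w kappa1_def)
    show "coincide w (i + 2 * length ?a + length ?b)
        (i + 2 * length ?a + 2 * length ?b + length ?c) (length ?c)"
      by (rule coincide_factors[of w i j "?a @ ?b @ ?a" ?c "?b @ ?c @ ?a @ ?b @ ?a @ ?c"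
          "?a @ ?b @ ?a @ ?c @ ?b" "?a @ ?b @ ?a @ ?c"]) (simp_all add: w kappa1_def)
    show "coincide w i (i + 2 * (length ?a + length ?b + length ?c))
        (2 * length ?a + length ?b + length ?c)"
      by (rule coincide_factors[of w i j "[]" "?a @ ?b @ ?a @ ?c" "?b @ ?c @ ?a @ ?b @ ?a @ ?c"
          "?a @ ?b @ ?a @ ?c @ ?b @ ?c" "[]"]) (simp_all add: w kappa1_def)
  qed
  then show thesis using that h by (meson length_greater_0_conv)
qed


section \<open>Desubstitution\<close>

lemma coincide_sync:
  assumes "coincide leech i (i + d) n" "8 \<le> n"
  shows "13 dvd d"
proof -
  have "coincide leech i (i + d) 8"
    using assms by (simp add: coincide_iff)
  then have "i mod 13 = (i + d) mod 13"
    unfolding coincide_def by (rule leech_sync)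
  then show ?thesis
    using mod_eq_dvd_iff_nat[of i "i + d" 13] by simp
qed

text \<open>
  Every block met by \<^term>\<open>13 * n\<close> consecutive letters, apart from a last incomplete one, shows its
  last letter there, and that letter is the one whose image the block is. So the equality of the long
  factors passes to the factors of their preimages, whatever the residue of \<^term>\<open>i\<close>.
\<close>

lemma coincide_desubst:
  assumes "coincide leech (i + 13 * s) (i + 13 * t) (13 * n)"
  shows "coincide leech (i div 13 + s) (i div 13 + t) n"
  unfolding coincide_iff
proof (intro allI impI)
  fix k assume "k < n"
  \<comment> \<open>the offset of the last letter of the block with index \<^term>\<open>i div 13 + k\<close>\<close>
  define m where "m = 13 * k + (12 - i mod 13)"
  have "m < 13 * n" using \<open>k < n\<close> by (simp add: m_def)
  then have eq: "leech (i + 13 * s + m) = leech (i + 13 * t + m)"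
    using assms by (simp add: coincide_iff)
  have last: "i + 13 * l + m = 13 * (i div 13 + l + k) + 12" for l
    unfolding m_def by presburger
  show "leech (i div 13 + s + k) = leech (i div 13 + t + k)"
    using eq unfolding last leech_last .
qed


section \<open>No instance of the first pattern\<close>

text \<open>
  Two words \<open>s u v t\<close> and \<open>s v u t\<close> with single letters \<open>s\<close>, \<open>t\<close> and with \<open>u\<close>, \<open>v\<close> of lengths from 1
  to 7 never occur at the same residue. Here \<open>s\<close> and \<open>t\<close> stand for the last and the first letter of
  the surrounding occurrences of \<open>b\<close>. Without these letters the claim fails: for instance
  the factors of lengths 1 and 2 can be exchanged.
\<close>

lemma swap_check:
  "list_all (\<lambda>u. list_all (\<lambda>v. list_all (\<lambda>r.
     let x = drop r (leech_subst u); y = drop r (leech_subst v) in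
     take 1 x \<noteq> take 1 y \<or> list_all (\<lambda>a. list_all (\<lambda>c.
       take a (drop 1 x) \<noteq> take a (drop (1 + c) y) \<or>
       take c (drop (1 + a) x) \<noteq> take c (drop 1 y) \<or>
       take 1 (drop (1 + a + c) x) \<noteq> take 1 (drop (1 + a + c) y))
     [1..<8]) [1..<8]) [0..<13]) letter_triples) letter_triples"
  by code_simp

lemma no_swapped_gaps:
  assumes "13 dvd d" "a < 8" "c < 8" "0 < a" "0 < c"
    and "leech g = leech (g + d)"
    and "coincide leech (Suc g) (Suc g + d + c) a"
    and "coincide leech (Suc g + a) (Suc g + d) c"
  shows "leech (Suc g + a + c) \<noteq> leech (Suc g + d + a + c)"
proof
  assume last: "leech (Suc g + a + c) = leech (Suc g + d + a + c)"
  define r where "r = g mod 13"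
  have r: "r < 13" "(g + d) mod 13 = r"
    using assms(1) by (auto simp: r_def mod_add_eq[symmetric])
  define x where "x = drop r (leech_subst (leech [g div 13 \<rightarrow> g div 13 + 3]))"
  define y where "y = drop r (leech_subst (leech [(g + d) div 13 \<rightarrow> (g + d) div 13 + 3]))"
  have window_x: "leech [g + s \<rightarrow> g + s + k] = take k (drop s x)" if "s + k \<le> 26" for s k
    using window_after[of s k g] that by (simp add: x_def r_def)
  have window_y: "leech [g + d + s \<rightarrow> g + d + s + k] = take k (drop s y)" if "s + k \<le> 26" for s k
    using window_after[of s k "g + d"] that r(2) by (simp add: y_def)
  have eq: "take k (drop s x) = take k (drop t y)"
    if "coincide leech (g + s) (g + d + t) k" "s + k \<le> 26" "t + k \<le> 26" for s t k
    using that by (simp add: coincide_def window_x window_y)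
  have "take 1 x = take 1 y"
    using eq[of 0 0 1] assms by (simp add: coincide_iff)
  moreover have "take a (drop 1 x) = take a (drop (1 + c) y)"
    using eq[of 1 "1 + c" a] assms by simp
  moreover have "take c (drop (1 + a) x) = take c (drop 1 y)"
    using eq[of "1 + a" 1 c] assms by simp
  moreover have "take 1 (drop (1 + a + c) x) = take 1 (drop (1 + a + c) y)"
    using eq[of "1 + a + c" "1 + a + c" 1] last assms by (simp add: coincide_iff add.assoc)
  moreover have "r \<in> set [0..<13]" "a \<in> set [1..<8]" "c \<in> set [1..<8]"
    using r(1) assms by simp_all
  moreover have "\<forall>u\<in>set letter_triples. \<forall>v\<in>set letter_triples. \<forall>r\<in>set [0..<13].
     let x = drop r (leech_subst u); y = drop r (leech_subst v) in
     take 1 x \<noteq> take 1 y \<or> (\<forall>a\<in>set [1..<8]. \<forall>c\<in>set [1..<8].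
       take a (drop 1 x) \<noteq> take a (drop (1 + c) y) \<or>
       take c (drop (1 + a) x) \<noteq> take c (drop 1 y) \<or>
       take 1 (drop (1 + a + c) x) \<noteq> take 1 (drop (1 + a + c) y))"
    using swap_check unfolding list_all_iff .
  ultimately show False
    using leech_triples[of "g div 13"] leech_triples[of "(g + d) div 13"]
    unfolding Let_def x_def y_def by meson
qed

text \<open>
  The ranges cover all positive lengths with \<open>2 a + b + c\<close> below 8. The two occurrences of \<open>a b a c\<close>
  then end after at most \<open>4 a + 3 b + 3 c\<close>, hence fewer than 26, letters.
\<close>

lemma small_check:
  "list_all (\<lambda>u. list_all (\<lambda>r. let x = drop r (leech_subst u) in
     list_all (\<lambda>a. list_all (\<lambda>b. list_all (\<lambda>c. 8 \<le> 2 * a + b + c \<or>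
       take a x \<noteq> take a (drop (a + b) x) \<or>
       take b (drop a x) \<noteq> take b (drop (2 * a + b + c) x) \<or>
       take (2 * a + b + c) x \<noteq> take (2 * a + b + c) (drop (2 * (a + b + c)) x))
     [1..<5]) [1..<5]) [1..<3])
     [0..<13]) letter_triples"
  by code_simp

lemma no_short_instance:
  assumes "0 < a" "0 < b" "0 < c" "2 * a + b + c < 8"
  shows "\<not> kappa1_at leech i a b c"
proof
  assume inst: "kappa1_at leech i a b c"
  define r x where "r = i mod 13" and "x = drop r (leech_subst (leech [i div 13 \<rightarrow> i div 13 + 3]))"
  have window: "leech [i + s \<rightarrow> i + s + k] = take k (drop s x)" if "s + k \<le> 26" for s k
    using window_after[OF that, of i] by (simp add: x_def r_def)
  have eq: "take k (drop s x) = take k (drop t x)"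
    if "coincide leech (i + s) (i + t) k" "s + k \<le> 26" "t + k \<le> 26" for s t k
    using that by (simp add: coincide_def window)
  have "take a x = take a (drop (a + b) x)"
    using eq[of 0 "a + b" a] inst assms by (simp add: kappa1_at_def add.assoc)
  moreover have "take b (drop a x) = take b (drop (2 * a + b + c) x)"
    using eq[of a "2 * a + b + c" b] inst assms by (simp add: kappa1_at_def add.assoc)
  moreover have "take (2 * a + b + c) x = take (2 * a + b + c) (drop (2 * (a + b + c)) x)"
    using eq[of 0 "2 * (a + b + c)" "2 * a + b + c"] inst assms
    by (simp add: kappa1_at_def add.assoc)
  moreover have "r \<in> set [0..<13]" "a \<in> set [1..<3]" "b \<in> set [1..<5]" "c \<in> set [1..<5]"
    using assms by (simp_all add: r_def)
  moreover have "\<not> 8 \<le> 2 * a + b + c" using assms(4) by simp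
  ultimately show False
    using small_check leech_triples[of "i div 13"]
    unfolding list_all_iff Let_def x_def by meson
qed

text \<open>
  Among the instances, one with \<^term>\<open>a + b + c\<close> minimal would yield a smaller one by desubstitution.
\<close>

lemma no_kappa1_at:
  assumes "0 < a" "0 < b" "0 < c"
  shows "\<not> kappa1_at leech i a b c"
  using assms
proof (induction "a + b + c" arbitrary: i a b c rule: less_induct)
  case less
  show ?case
  proof
    assume inst: "kappa1_at leech i a b c"
    have pos: "i + a + b = i + (a + b)" "i + 2 * a + b + c = i + a + (a + b + c)"
      "i + 2 * a + 2 * b + c = i + 2 * a + b + (b + c)"
      by simp_all
    have a: "coincide leech i (i + (a + b)) a"
      and b: "coincide leech (i + a) (i + a + (a + b + c)) b"
      and c: "coincide leech (i + 2 * a + b) (i + 2 * a + b + (b + c)) c"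
      and abac: "coincide leech i (i + 2 * (a + b + c)) (2 * a + b + c)"
      using inst unfolding kappa1_at_def pos by blast+
    have "8 \<le> 2 * a + b + c"
      using no_short_instance[OF less.prems] inst by force
    then have "13 dvd 2 * (a + b + c)"
      using coincide_sync[OF abac] by blast
    then have abc: "13 dvd a + b + c"
      by presburger
    have dvd_a: "8 \<le> a \<Longrightarrow> 13 dvd a + b"
      and dvd_c: "8 \<le> c \<Longrightarrow> 13 dvd b + c"
      using coincide_sync[OF a] coincide_sync[OF c] by blast+
    have from_a: "13 dvd a \<Longrightarrow> 8 \<le> a" and from_c: "13 dvd c \<Longrightarrow> 8 \<le> c"
      using less.prems dvd_imp_le[of 13] by force+
    \<comment> \<open>The words \<open>ac\<close> and \<open>ca\<close> between the three occurrences of \<open>b\<close> start at the same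
      residue, since consecutive occurrences of \<open>b\<close> are at distance \<^term>\<open>a + b + c\<close>.
      The witness \<open>g\<close> is the position of the last letter of the first \<open>b\<close>.\<close>
    have "\<not> (a < 8 \<and> c < 8)"
    proof
      assume ac: "a < 8 \<and> c < 8"
      obtain g where g: "Suc g = i + a + b" "1 \<le> b"
        using less.prems by (cases b) auto
      have "i + a + (b - 1) = g" "i + a + (a + b + c) + (b - 1) = g + (a + b + c)"
        using g by simp_all
      then have first: "leech g = leech (g + (a + b + c))"
        using b[unfolded coincide_iff, rule_format, of "b - 1"] g(2) by simp
      have "coincide leech (i + (a + b)) (i + 2 * (a + b + c)) a"
        unfolding coincide_iff
      proof (intro allI impI)
        fix k assume "k < a"
        then have "k < 2 * a + b + c" by simp
        with \<open>k < a\<close> a abac show "leech (i + (a + b) + k) = leech (i + 2 * (a + b + c) + k)"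
          unfolding coincide_iff by metis
      qed
      moreover have "i + (a + b) = Suc g" "i + 2 * (a + b + c) = Suc g + (a + b + c) + c"
        using g by simp_all
      ultimately have gap_a: "coincide leech (Suc g) (Suc g + (a + b + c) + c) a"
        by (simp only:)
      have "i + 2 * a + b = Suc g + a" "i + 2 * a + b + (b + c) = Suc g + (a + b + c)"
        using g by simp_all
      then have gap_c: "coincide leech (Suc g + a) (Suc g + (a + b + c)) c"
        using c by (simp only:)
      have "leech (i + a + 0) = leech (i + a + (a + b + c) + 0)"
        using b less.prems unfolding coincide_iff by blast
      moreover have "leech (i + a) = leech (i + 2 * (a + b + c) + a)"
        using abac less.prems unfolding coincide_iff by simp
      moreover have "Suc g + a + c = i + a + (a + b + c)"
          "Suc g + (a + b + c) + a + c = i + 2 * (a + b + c) + a"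
        using g by simp_all
      ultimately have "leech (Suc g + a + c) = leech (Suc g + (a + b + c) + a + c)"
        by (metis add_0_right)
      then show False
        using no_swapped_gaps[OF abc _ _ _ _ first gap_a gap_c] ac less.prems by blast
    qed
    \<comment> \<open>If \<open>a\<close> is at least 8, then 13 divides \<open>a + b\<close> and so also \<open>c\<close>; a positive multiple of 13 is
      at least 8, so 13 divides \<open>b + c\<close> as well. The case of \<open>c\<close> is symmetric.\<close>
    then have "13 dvd a \<and> 13 dvd b \<and> 13 dvd c"
      using dvd_a dvd_c from_a from_c abc by presburger
    then obtain a' b' c' where eqs: "a = 13 * a'" "b = 13 * b'" "c = 13 * c'"
      by (auto elim!: dvdE)
    have "kappa1_at leech (i div 13) a' b' c'"
      using coincide_desubst[of i 0 "a' + b'" a'] coincide_desubst[of i a' "2 * a' + b' + c'" b']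
        coincide_desubst[of i "2 * a' + b'" "2 * a' + 2 * b' + c'" c']
        coincide_desubst[of i 0 "2 * (a' + b' + c')" "2 * a' + b' + c'"]
        inst unfolding kappa1_at_def eqs by (simp add: algebra_simps)
    then show False
      using less.hyps[of a' b' c'] less.prems eqs by auto
  qed
qed

lemma no_instance_kappa1: "\<not> has_instance kappa1 leech"
  using has_instance_kappa1[of leech] no_kappa1_at by metis


section \<open>Reversal and prefixes\<close>

lemma rev_leech_subst: "rev (leech_subst u) = leech_subst (rev u)"
proof (induction u)
  case Nil
  then show ?case by (simp add: leech_subst_def)
next
  case (Cons x u)
  have "rev (leech_block x) = leech_block x" by (cases x) simp_all
  with Cons show ?case by (simp add: leech_subst_def)
qed

lemma rev_leech_iter: "rev (leech_iter n) = leech_iter n"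
  by (induction n) (simp_all add: leech_iter_0 leech_iter_Suc rev_leech_subst)

text \<open>The iterates of the substitution are palindromic prefixes of the Leech word.\<close>

lemma leech_mirror:
  assumes "t < 13 ^ n"
  shows "leech (13 ^ n - Suc t) = leech t"
proof -
  have "leech t = rev (leech_iter n) ! t"
    using assms by (simp add: rev_leech_iter leech_nth length_leech_iter)
  also have "\<dots> = leech_iter n ! (13 ^ n - Suc t)"
    using assms by (simp add: rev_nth length_leech_iter)
  also have "\<dots> = leech (13 ^ n - Suc t)"
    using assms by (intro leech_nth[symmetric]) (simp add: length_leech_iter)
  finally show ?thesis ..
qed

lemma occurs_in_leech_rev:
  assumes "occurs_in u leech"
  shows "occurs_in (rev u) leech"
proof -
  obtain i j where u: "u = leech [i \<rightarrow> j]"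
    using assms unfolding occurs_in_def by blast
  \<comment> \<open>any palindromic prefix that contains the factor would do\<close>
  define N :: nat where "N = 13 ^ j"
  have "j < N"
    using less_length_leech_iter[of j] by (simp add: N_def length_leech_iter)
  have "rev u = leech [N - j \<rightarrow> N - j + (j - i)]"
  proof (rule nth_equalityI)
    fix t assume "t < length (rev u)"
    then have t: "t < j - i" by (simp add: u)
    then have "rev u ! t = leech (j - Suc t)"
      by (simp add: u rev_nth)
    also have "\<dots> = leech (N - Suc (j - Suc t))"
      unfolding N_def using \<open>j < N\<close> by (intro leech_mirror[symmetric]) (simp add: N_def)
    also have "N - Suc (j - Suc t) = N - j + t"
      using t \<open>j < N\<close> by simp
    finally show "rev u ! t = leech [N - j \<rightarrow> N - j + (j - i)] ! t"
      using t by simp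
  qed (simp add: u)
  then show ?thesis unfolding occurs_in_def by blast
qed

lemma hom_ext_rev: "hom_ext (\<lambda>v. rev (h v)) (rev p) = rev (hom_ext h p)"
  by (induction p) simp_all

lemma has_instance_leech_rev:
  assumes "has_instance p leech"
  shows "has_instance (rev p) leech"
proof -
  obtain h where h: "\<forall>v. h v \<noteq> []" "occurs_in (hom_ext h p) leech"
    using assms unfolding has_instance_def by blast
  have "occurs_in (hom_ext (\<lambda>v. rev (h v)) (rev p)) leech"
    unfolding hom_ext_rev using h(2) by (rule occurs_in_leech_rev)
  then show ?thesis
    unfolding has_instance_def using h(1) by (intro exI[of _ "\<lambda>v. rev (h v)"]) simp
qed

lemma has_instance_append:
  assumes "has_instance (p @ q) w"
  shows "has_instance p w"
proof -
  obtain h i j where h: "\<forall>v. h v \<noteq> []" and "hom_ext h (p @ q) = w [i \<rightarrow> j]"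
    using assms unfolding has_instance_def occurs_in_def by blast
  then have "w [i \<rightarrow> j] = [] @ hom_ext h p @ hom_ext h q" by simp
  from factor_middle[OF this] h show ?thesis
    unfolding has_instance_def occurs_in_def by blast
qed

theorem theorem9:
  shows "\<not> has_instance kappa1 leech \<and> \<not> has_instance kappa3 leech \<and> \<not> has_instance kappa4 leech"
proof -
  have "rev kappa3 = kappa1" and "kappa4 = kappa3 @ [Vc]"
    by (simp_all add: kappa1_def kappa3_def kappa4_def)
  then show ?thesis
    using no_instance_kappa1 has_instance_leech_rev has_instance_append by metis
qed

end
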